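(* Let $(W,S)$ be a Coxeter system with $S$ finite, and let $\mathcal{A}=(Y,\mu,o)$ be a reduced automaton recognising $\mathcal{L}(W,S)$. The partition $\mathscr{R}(\mathcal{A})$ of $W$ into sets $$A_y=\{w\in W\mid\mu(o,w^{-1})=y\},\quad\text{with } y\in Y,$$ is a regular partition of $W$. Moreover, let $\mathscr{P}_{\mathrm{reg}}(W)$ be the set of all regular partitions of $W$ and let $\mathbf{A}_{\mathrm{red}}(W,S)$ be the set of isomorphism classes of reduced automata recognising $\mathcal{L}(W,S)$. The functions $F:\mathscr{P}_{\mathrm{reg}}(W)\to\mathbf{A}_{\mathrm{red}}(W,S)$ and $G:\mathbf{A}_{\mathrm{red}}(W,S)\to\mathscr{P}_{\mathrm{reg}}(W)$ with $F(\mathscr{R})=\mathcal{A}(\mathscr{R})$ and $G(\mathcal{A})=\mathscr{R}(\mathcal{A})$ are mutually inverse bijections.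
   Context: $\ell$ is the length function of $(W,S)$, $e$ the identity, and $D_L(w)=\{s\in S\mid\ell(sw)=\ell(w)-1\}$ for $w\in W$. A partition of $W$ is a set of pairwise disjoint subsets of $W$ (the parts) with union $W$. A partition $\mathscr{R}$ is regular if: (1) $D_L$ is constant on each part $R$ (the common value is written $D_L(R)$); and (2) if $R\in\mathscr{R}$ and $s\in S\setminus D_L(R)$ then $sR\subseteq R'$ for some part $R'\in\mathscr{R}$. (By (1) the part containing $e$ is $\{e\}$.) A word $(s_1,\ldots,s_n)\in S^n$ is reduced if $\ell(s_1\cdots s_n)=n$; $\mathcal{L}(W,S)$ is the set of all reduced words. An automaton with alphabet $S$ is $\mathcal{A}=(Y,\mu,o)$, where $Y$ is a set of states (not necessarily finite), $o\in Y$ is the start state, $\dagger\notin Y$ is a dead state, and $\mu:(Y\cup\{\dagger\})\times S\to Y\cup\{\dagger\}$ satisfies $\mu(\dagger,s)=\dagger$ for all $s\in S$. A word $(s_1,\ldots,s_n)$ is accepted if $y_n\in Y$, where $y_0=o$ and $y_j=\mu(y_{j-1},s_j)$ for $1\leq j\leq n$; $\mathcal{A}$ recognises $\mathcal{L}(W,S)$ if its set of accepted words is exactly $\mathcal{L}(W,S)$. An automaton recognising $\mathcal{L}(W,S)$ is reduced if whenever $w=s_1\cdots s_n$ and $w=s_1'\cdots s_n'$ are both reduced expressions for the same element $w\in W$, the paths starting at $o$ with edge labels $(s_1,\ldots,s_n)$ and $(s_1',\ldots,s_n')$ finish at the same state. For reduced $\mathcal{A}$ and $w\in W$, $\mu(o,w)$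 denotes the common end state of these paths over all reduced expressions of $w$. Automata $(Y,\mu,o)$ and $(Y',\mu',o')$ recognising $\mathcal{L}(W,S)$, with dead states $\dagger$ and $\dagger'$, are isomorphic if there is a function $f:Y\cup\{\dagger\}\to Y'\cup\{\dagger'\}$, injective on $Y$, such that: $f(o)=o'$, $f(\dagger)=\dagger'$ and $f(Y)=Y'$; if $x,y\in Y$ with $\mu(x,s)=y$ then $\mu'(f(x),s)=f(y)$; and if $x',y'\in Y'$ with $\mu'(x',s)=y'$ then there exist $x,y\in Y$ with $f(x)=x'$, $f(y)=y'$ and $\mu(x,s)=y$. For a regular partition $\mathscr{R}$, $\mathcal{A}(\mathscr{R})=(\mathscr{R},\mu,\{e\})$ is the automaton (it is reduced and recognises $\mathcal{L}(W,S)$) whose states are the parts of $\mathscr{R}$, whose start state is the part $\{e\}$, and whose transition function is $\mu(R,s)=R'$ if $s\notin D_L(R)$ and $sR\subseteq R'\in\mathscr{R}$, and $\mu(R,s)=\dagger$ if $s\in D_L(R)$.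
   Formalization: Bijections are stated for automata whose states are all reachable from o (adding unreachable states changes the class but not the nonempty A_y, so G is not injective otherwise); empty A_y are dropped from R(A); states lie in any fixed set into which W embeds. *)

theory Defs
  imports "HOL-Algebra.Coset" "HOL-Library.Disjoint_Sets"
begin

section \<open>Coxeter systems\<close>

text \<open>Words in the free group on \<open>S\<close> are lists of signed letters; the flag \<open>False\<close> marks a
  formal inverse. The relation below is the congruence on such words generated by free
  cancellation and by the relators, so the words over \<open>S\<close> modulo this congruence form the
  group presented by \<open>S\<close> and \<open>Rels\<close>.\<close>

type_synonym 'a gword = "('a \<times> bool) list"

definition gwords :: "'a set \<Rightarrow> 'a gword set" where
  "gwords S = lists (S \<times> UNIV)"

inductive pres_eq :: "'a set \<Rightarrow> 'a gword set \<Rightarrow> 'a gword \<Rightarrow> 'a gword \<Rightarrow> bool"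
  for S :: "'a set" and Rels :: "'a gword set" where
  refl: "u \<in> gwords S \<Longrightarrow> pres_eq S Rels u u"
| sym: "pres_eq S Rels u v \<Longrightarrow> pres_eq S Rels v u"
| trans: "pres_eq S Rels u v \<Longrightarrow> pres_eq S Rels v w \<Longrightarrow> pres_eq S Rels u w"
| cancel: "u \<in> gwords S \<Longrightarrow> v \<in> gwords S \<Longrightarrow> s \<in> S
    \<Longrightarrow> pres_eq S Rels (u @ [(s, b), (s, \<not> b)] @ v) (u @ v)"
| relator: "u \<in> gwords S \<Longrightarrow> v \<in> gwords S \<Longrightarrow> r \<in> Rels
    \<Longrightarrow> pres_eq S Rels (u @ r @ v) (u @ v)"

definition word_prod :: "('w, 'b) monoid_scheme \<Rightarrow> 'w list \<Rightarrow> 'w" where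
  "word_prod W ws = foldr (\<lambda>x y. x \<otimes>\<^bsub>W\<^esub> y) ws \<one>\<^bsub>W\<^esub>"

definition gword_val :: "('w, 'b) monoid_scheme \<Rightarrow> 'w gword \<Rightarrow> 'w" where
  "gword_val W u = word_prod W (map (\<lambda>(s, b). if b then s else inv\<^bsub>W\<^esub> s) u)"

definition presented_by :: "('w, 'b) monoid_scheme \<Rightarrow> 'w set \<Rightarrow> 'w gword set \<Rightarrow> bool" where
  "presented_by W S Rels \<longleftrightarrow>
     group W \<and> S \<subseteq> carrier W \<and> Rels \<subseteq> gwords S \<and>
     gword_val W ` gwords S = carrier W \<and>
     (\<forall>u \<in> gwords S. \<forall>v \<in> gwords S. gword_val W u = gword_val W v \<longleftrightarrow> pres_eq S Rels u v)"

text \<open>The entry \<open>0\<close> of a Coxeter matrix encodes \<open>\<infinity>\<close>.\<close>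

definition coxeter_matrix :: "'a set \<Rightarrow> ('a \<Rightarrow> 'a \<Rightarrow> nat) \<Rightarrow> bool" where
  "coxeter_matrix S m \<longleftrightarrow>
     (\<forall>s \<in> S. m s s = 1) \<and>
     (\<forall>s \<in> S. \<forall>t \<in> S. m s t = m t s \<and> (s \<noteq> t \<longrightarrow> m s t = 0 \<or> m s t \<ge> 2))"

definition coxeter_relators :: "'a set \<Rightarrow> ('a \<Rightarrow> 'a \<Rightarrow> nat) \<Rightarrow> 'a gword set" where
  "coxeter_relators S m =
     {concat (replicate (m s t) [(s, True), (t, True)]) | s t. s \<in> S \<and> t \<in> S \<and> m s t \<noteq> 0}"

definition coxeter_system :: "('w, 'b) monoid_scheme \<Rightarrow> 'w set \<Rightarrow> bool" where
  "coxeter_system W S \<longleftrightarrow>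
     (\<exists>m. coxeter_matrix S m \<and> presented_by W S (coxeter_relators S m))"

definition len :: "('w, 'b) monoid_scheme \<Rightarrow> 'w set \<Rightarrow> 'w \<Rightarrow> nat" where
  "len W S w = (LEAST n. \<exists>ws \<in> lists S. length ws = n \<and> word_prod W ws = w)"

definition left_descents :: "('w, 'b) monoid_scheme \<Rightarrow> 'w set \<Rightarrow> 'w \<Rightarrow> 'w set" where
  "left_descents W S w = {s \<in> S. len W S (s \<otimes>\<^bsub>W\<^esub> w) + 1 = len W S w}"

definition reduced_words :: "('w, 'b) monoid_scheme \<Rightarrow> 'w set \<Rightarrow> 'w list set" where
  "reduced_words W S = {ws \<in> lists S. len W S (word_prod W ws) = length ws}"

section \<open>Regular partitions\<close>

text \<open>The common value of the left descent sets on a part of a regular partition.\<close>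

definition part_descents :: "('w, 'b) monoid_scheme \<Rightarrow> 'w set \<Rightarrow> 'w set \<Rightarrow> 'w set" where
  "part_descents W S R = the_elem (left_descents W S ` R)"

definition regular_partition :: "('w, 'b) monoid_scheme \<Rightarrow> 'w set \<Rightarrow> 'w set set \<Rightarrow> bool" where
  "regular_partition W S P \<longleftrightarrow>
     partition_on (carrier W) P \<and>
     (\<forall>R \<in> P. \<forall>v \<in> R. \<forall>w \<in> R. left_descents W S v = left_descents W S w) \<and>
     (\<forall>R \<in> P. \<forall>s \<in> S - part_descents W S R. \<exists>R' \<in> P. s <#\<^bsub>W\<^esub> R \<subseteq> R')"

definition regular_partitions :: "('w, 'b) monoid_scheme \<Rightarrow> 'w set \<Rightarrow> 'w set set set" where
  "regular_partitions W S = {P. regular_partition W S P}"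

section \<open>Automata\<close>

text \<open>The dead state is \<open>None\<close>, and a state \<open>y\<close> of the automaton is represented by \<open>Some y\<close> as an
  argument or value of the transition function. Only the values of the transition function on
  actual states (including the dead one) and letters of the alphabet are meaningful.\<close>

record ('q, 'a) automaton =
  states :: "'q set"
  transition :: "'q option \<Rightarrow> 'a \<Rightarrow> 'q option"
  start :: 'q

definition live :: "('q, 'a, 'z) automaton_scheme \<Rightarrow> 'q option set" where
  "live A = Some ` states A"

definition is_automaton :: "'a set \<Rightarrow> ('q, 'a) automaton \<Rightarrow> bool" where
  "is_automaton S A \<longleftrightarrow>
     start A \<in> states A \<and>
     (\<forall>q \<in> live A \<union> {None}. \<forall>s \<in> S. transition A q s \<in> live A \<union> {None}) \<and>
     (\<forall>s \<in> S. transition A None s = None)"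

definition end_state :: "('q, 'a) automaton \<Rightarrow> 'a list \<Rightarrow> 'q option" where
  "end_state A ws = foldl (transition A) (Some (start A)) ws"

definition accepted_words :: "'a set \<Rightarrow> ('q, 'a) automaton \<Rightarrow> 'a list set" where
  "accepted_words S A = {ws \<in> lists S. end_state A ws \<in> live A}"

definition recognises_reduced ::
  "('w, 'b) monoid_scheme \<Rightarrow> 'w set \<Rightarrow> ('q, 'w) automaton \<Rightarrow> bool" where
  "recognises_reduced W S A \<longleftrightarrow>
     is_automaton S A \<and> accepted_words S A = reduced_words W S"

definition reduced_automaton ::
  "('w, 'b) monoid_scheme \<Rightarrow> 'w set \<Rightarrow> ('q, 'w) automaton \<Rightarrow> bool" where
  "reduced_automaton W S A \<longleftrightarrow>
     recognises_reduced W S A \<and>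
     (\<forall>ws \<in> reduced_words W S. \<forall>ws' \<in> reduced_words W S.
        word_prod W ws = word_prod W ws' \<longrightarrow> end_state A ws = end_state A ws')"

definition accessible :: "'a set \<Rightarrow> ('q, 'a) automaton \<Rightarrow> bool" where
  "accessible S A \<longleftrightarrow> (\<forall>y \<in> states A. \<exists>ws \<in> lists S. end_state A ws = Some y)"

text \<open>For a reduced automaton, \<open>reach W S A w\<close> is the state usually written \<open>\<mu>(o,w)\<close>.\<close>

definition reach ::
  "('w, 'b) monoid_scheme \<Rightarrow> 'w set \<Rightarrow> ('q, 'w) automaton \<Rightarrow> 'w \<Rightarrow> 'q option" where
  "reach W S A w =
     (THE q. \<forall>ws \<in> reduced_words W S. word_prod W ws = w \<longrightarrow> end_state A ws = q)"

definition automaton_iso_map ::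
  "'a set \<Rightarrow> ('q, 'a) automaton \<Rightarrow> ('r, 'a) automaton \<Rightarrow> ('q option \<Rightarrow> 'r option) \<Rightarrow> bool" where
  "automaton_iso_map S A B f \<longleftrightarrow>
     inj_on f (live A) \<and>
     f (Some (start A)) = Some (start B) \<and> f None = None \<and> f ` live A = live B \<and>
     (\<forall>x \<in> live A. \<forall>y \<in> live A. \<forall>s \<in> S. transition A x s = y \<longrightarrow> transition B (f x) s = f y) \<and>
     (\<forall>x' \<in> live B. \<forall>y' \<in> live B. \<forall>s \<in> S. transition B x' s = y' \<longrightarrow>
        (\<exists>x \<in> live A. \<exists>y \<in> live A. f x = x' \<and> f y = y' \<and> transition A x s = y))"

definition isomorphic_automata ::
  "'a set \<Rightarrow> ('q, 'a) automaton \<Rightarrow> ('r, 'a) automaton \<Rightarrow> bool" where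
  "isomorphic_automata S A B \<longleftrightarrow> (\<exists>f. automaton_iso_map S A B f)"

text \<open>Isomorphism classes are formed among the automata whose states lie in the type \<open>'q\<close>.
  Accessibility is needed: inaccessible states can be added to an automaton without affecting the
  words it accepts or the sets \<open>A\<^sub>y\<close> with \<open>y\<close> accessible, so they are not determined by the
  partition.\<close>

definition reduced_automata ::
  "('w, 'b) monoid_scheme \<Rightarrow> 'w set \<Rightarrow> ('q, 'w) automaton set" where
  "reduced_automata W S = {A. reduced_automaton W S A \<and> accessible S A}"

definition reduced_automata_classes ::
  "('w, 'b) monoid_scheme \<Rightarrow> 'w set \<Rightarrow> ('q, 'w) automaton set set" where
  "reduced_automata_classes W S =
     reduced_automata W S //
       {(A, B). A \<in> reduced_automata W S \<and> B \<in> reduced_automata W S \<and> isomorphic_automata S A B}"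

section \<open>The two constructions\<close>

definition automaton_of_partition ::
  "('w, 'b) monoid_scheme \<Rightarrow> 'w set \<Rightarrow> 'w set set \<Rightarrow> ('w set, 'w) automaton" where
  "automaton_of_partition W S P =
     \<lparr> states = P,
       transition = (\<lambda>q s. case q of
           None \<Rightarrow> None
         | Some R \<Rightarrow> if s \<in> part_descents W S R then None
                     else Some (THE R'. R' \<in> P \<and> s <#\<^bsub>W\<^esub> R \<subseteq> R')),
       start = {\<one>\<^bsub>W\<^esub>} \<rparr>"

definition state_part ::
  "('w, 'b) monoid_scheme \<Rightarrow> 'w set \<Rightarrow> ('q, 'w) automaton \<Rightarrow> 'q \<Rightarrow> 'w set" where
  "state_part W S A y = {w \<in> carrier W. reach W S A (inv\<^bsub>W\<^esub> w) = Some y}"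

definition partition_of_automaton ::
  "('w, 'b) monoid_scheme \<Rightarrow> 'w set \<Rightarrow> ('q, 'w) automaton \<Rightarrow> 'w set set" where
  "partition_of_automaton W S A = {state_part W S A y | y. y \<in> states A}"

text \<open>The isomorphism class of the automaton of a partition: its states are sets of group elements,
  and the members of the class are the isomorphic automata with states in the type \<open>'q\<close>.\<close>

definition class_of_partition ::
  "('w, 'b) monoid_scheme \<Rightarrow> 'w set \<Rightarrow> 'w set set \<Rightarrow> ('q, 'w) automaton set" where
  "class_of_partition W S P =
     {A \<in> reduced_automata W S. isomorphic_automata S (automaton_of_partition W S P) A}"

text \<open>This is meaningful because isomorphic automata have the same partition.\<close>

definition partition_of_class ::
  "('w, 'b) monoid_scheme \<Rightarrow> 'w set \<Rightarrow> ('q, 'w) automaton set \<Rightarrow> 'w set set" where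
  "partition_of_class W S C = the_elem (partition_of_automaton W S ` C)"

end

theory Submission
  imports Defs
begin

text \<open>A reduced automaton reads a reduced word of \<open>w\<inverse>\<close> and then a letter \<open>s\<close> exactly when \<open>s\<close> is
  not a left descent of \<open>w\<close>, and it then arrives at the state of \<open>(s w)\<inverse>\<close>. So the part \<open>A\<^sub>y\<close>
  determines the transitions at \<open>y\<close>: there is an edge \<open>x \<rightarrow> y\<close> labelled \<open>s\<close> if and only if
  \<open>s\<close> is not a descent of \<open>A\<^sub>x\<close> and \<open>s A\<^sub>x \<subseteq> A\<^sub>y\<close>. This is the regularity of the partition, and it
  shows that two accessible reduced automata are isomorphic if and only if their partitions agree.
  The only input from Coxeter groups is that the generators are involutions and that
  \<open>\<ell>(s w) \<noteq> \<ell>(w)\<close>, which holds because all relators have even length.\<close>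

section \<open>Length in groups generated by involutions\<close>

text \<open>The last assumption does not follow from the others: in the Klein four-group generated
  by all three involutions, the product of two distinct generators has length 1 again.\<close>

locale involution_generated_group = group W
  for W :: "('w, 'b) monoid_scheme" (structure) +
  fixes S :: "'w set"
  assumes generators_closed: "S \<subseteq> carrier W"
    and involution: "s \<in> S \<Longrightarrow> s \<otimes> s = \<one>"
    and generated: "w \<in> carrier W \<Longrightarrow> \<exists>ws \<in> lists S. word_prod W ws = w"
    and len_mult_neq: "s \<in> S \<Longrightarrow> w \<in> carrier W \<Longrightarrow> len W S (s \<otimes> w) \<noteq> len W S w"
begin

lemma generator_closed [simp, intro]: "s \<in> S \<Longrightarrow> s \<in> carrier W"
  using generators_closed by blast

lemma generator_inv: "s \<in> S \<Longrightarrow> inv s = s"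
  by (simp add: inv_equality involution)

lemma word_prod_Nil [simp]: "word_prod W [] = \<one>"
  and word_prod_Cons [simp]: "word_prod W (s # ws) = s \<otimes> word_prod W ws"
  by (simp_all add: word_prod_def)

lemma word_prod_closed [simp, intro]: "ws \<in> lists S \<Longrightarrow> word_prod W ws \<in> carrier W"
  by (induction ws) auto

lemma word_prod_append:
  "us \<in> lists S \<Longrightarrow> vs \<in> lists S \<Longrightarrow> word_prod W (us @ vs) = word_prod W us \<otimes> word_prod W vs"
  by (induction us) (auto simp: m_assoc)

lemma word_prod_rev: "ws \<in> lists S \<Longrightarrow> word_prod W (rev ws) = inv (word_prod W ws)"
proof (induction ws)
  case (Cons s ws)
  then have "word_prod W (rev (s # ws)) = word_prod W (rev ws) \<otimes> s"
    by (subst rev.simps, subst word_prod_append) (auto simp: in_lists_conv_set)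
  with Cons show ?case
    by (auto simp: inv_mult_group generator_inv)
qed simp

lemma len_word_prod_le: "ws \<in> lists S \<Longrightarrow> len W S (word_prod W ws) \<le> length ws"
  unfolding len_def by (rule Least_le) blast

lemma ex_reduced_word:
  assumes "w \<in> carrier W"
  obtains ws where "ws \<in> reduced_words W S" "word_prod W ws = w"
proof -
  have "\<exists>ws \<in> lists S. length ws = len W S w \<and> word_prod W ws = w"
    unfolding len_def by (rule LeastI_ex) (use generated[OF assms] in blast)
  then show ?thesis
    using that unfolding reduced_words_def by fastforce
qed

lemma reduced_words_lists: "ws \<in> reduced_words W S \<Longrightarrow> ws \<in> lists S"
  by (simp add: reduced_words_def)

text \<open>Since the generators are their own inverses, reversing a word for \<open>w\<close> gives
  a word of the same length for the inverse.\<close>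

lemma len_inv_le: "w \<in> carrier W \<Longrightarrow> len W S (inv w) \<le> len W S w"
proof (elim ex_reduced_word)
  fix ws assume ws: "ws \<in> reduced_words W S" "word_prod W ws = w"
  then have "len W S (word_prod W (rev ws)) \<le> length (rev ws)"
    by (intro len_word_prod_le) (auto simp: reduced_words_def in_lists_conv_set)
  with ws show ?thesis
    by (auto simp: word_prod_rev reduced_words_def)
qed

lemma len_inv: "w \<in> carrier W \<Longrightarrow> len W S (inv w) = len W S w"
  using len_inv_le[of w] len_inv_le[of "inv w"] by simp

lemma len_mult_le: "s \<in> S \<Longrightarrow> w \<in> carrier W \<Longrightarrow> len W S (s \<otimes> w) \<le> len W S w + 1"
proof (elim ex_reduced_word)
  fix ws assume "s \<in> S" "ws \<in> reduced_words W S" "word_prod W ws = w"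
  with len_word_prod_le[of "s # ws"] show ?thesis
    by (auto simp: reduced_words_def)
qed

text \<open>Multiplying by \<open>s\<close> twice gives back \<open>w\<close>, so one multiplication
  changes the length by at most 1 in either direction; \<open>len_mult_neq\<close> rules out no
  change, which leaves a descent or an increase by 1.\<close>

lemma not_left_descent_iff:
  assumes "s \<in> S" "w \<in> carrier W"
  shows "s \<notin> left_descents W S w \<longleftrightarrow> len W S (s \<otimes> w) = len W S w + 1"
proof -
  have "s \<otimes> (s \<otimes> w) = w"
    using assms by (simp add: m_assoc[symmetric] involution)
  then have "len W S w \<le> len W S (s \<otimes> w) + 1"
    using len_mult_le[of s "s \<otimes> w"] assms by simp
  then show ?thesis
    using len_mult_le[OF assms] len_mult_neq[OF assms] assms by (auto simp: left_descents_def)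
qed

section \<open>Appending a letter to a reduced word\<close>

lemma word_prod_snoc: "ws \<in> lists S \<Longrightarrow> s \<in> S \<Longrightarrow> word_prod W (ws @ [s]) = word_prod W ws \<otimes> s"
  by (subst word_prod_append) auto

lemma inv_word_prod_snoc:
  "ws \<in> lists S \<Longrightarrow> s \<in> S \<Longrightarrow> inv (word_prod W (ws @ [s])) = s \<otimes> inv (word_prod W ws)"
  by (simp add: word_prod_snoc inv_mult_group generator_inv)

text \<open>Automata extend words on the right, while descents and regularity concern multiplication
  on the left. Inversion translates between the two and preserves length.\<close>

lemma len_word_prod_snoc:
  "ws \<in> lists S \<Longrightarrow> s \<in> S \<Longrightarrow> len W S (word_prod W (ws @ [s])) = len W S (s \<otimes> inv (word_prod W ws))"
  by (subst len_inv[symmetric]) (auto simp: inv_word_prod_snoc)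

text \<open>The last letter raises the length by at most 1, so the prefix cannot represent an
  element shorter than itself.\<close>

lemma reduced_snocD:
  assumes "ws @ [s] \<in> reduced_words W S"
  shows "ws \<in> reduced_words W S"
proof -
  have ws: "ws \<in> lists S" "s \<in> S"
    using assms by (auto simp: reduced_words_def)
  have "length ws + 1 = len W S (s \<otimes> inv (word_prod W ws))"
    using assms len_word_prod_snoc[OF ws] by (simp add: reduced_words_def)
  also have "\<dots> \<le> len W S (word_prod W ws) + 1"
    using len_mult_le[of s "inv (word_prod W ws)"] ws by (simp add: len_inv)
  finally show ?thesis
    using len_word_prod_le[of ws] ws by (simp add: reduced_words_def)
qed

lemma reduced_snoc_iff:
  assumes "ws \<in> reduced_words W S" "s \<in> S"
  shows "ws @ [s] \<in> reduced_words W S \<longleftrightarrow> s \<notin> left_descents W S (inv (word_prod W ws))"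
proof -
  have "ws \<in> lists S" "len W S (word_prod W ws) = length ws"
    using assms by (auto simp: reduced_words_def)
  then show ?thesis
    using assms by (simp add: not_left_descent_iff len_word_prod_snoc len_inv reduced_words_def)
qed

lemma len_one [simp]: "len W S \<one> = 0"
  using len_word_prod_le[of "[]"] by simp

lemma Nil_reduced [simp]: "[] \<in> reduced_words W S"
  by (simp add: reduced_words_def)

text \<open>The last letter of a nonempty reduced word for \<open>inv w\<close> is a left descent of
  \<open>w\<close>. This later isolates the identity in a part of its own.\<close>

lemma left_descents_empty_iff:
  assumes "w \<in> carrier W"
  shows "left_descents W S w = {} \<longleftrightarrow> w = \<one>"
proof
  assume empty: "left_descents W S w = {}"
  obtain ws where ws: "ws \<in> reduced_words W S" "word_prod W ws = inv w"
    using assms by (meson ex_reduced_word inv_closed)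
  show "w = \<one>"
  proof (cases ws rule: rev_cases)
    case Nil
    then show ?thesis
      using ws assms inv_eq_1_iff by auto
  next
    case (snoc us s)
    have us: "us \<in> lists S" "s \<in> S" "us \<in> reduced_words W S"
      using ws(1) reduced_snocD unfolding snoc by (auto simp: reduced_words_def)
    have "w = s \<otimes> inv (word_prod W us)"
      using ws(2) inv_word_prod_snoc[OF us(1,2)] assms unfolding snoc by simp
    moreover from this have "s \<otimes> w = inv (word_prod W us)"
      using us by (simp add: m_assoc[symmetric] involution)
    moreover have "len W S (s \<otimes> inv (word_prod W us)) = len W S (inv (word_prod W us)) + 1"
      using ws(1) us reduced_snoc_iff not_left_descent_iff unfolding snoc by simp
    ultimately have "s \<in> left_descents W S w"
      using us by (auto simp: left_descents_def)
    with empty show ?thesis by blast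
  qed
qed (auto simp: left_descents_def)

section \<open>The partition of a reduced automaton\<close>

text \<open>Reducedness of the automaton provides a common end state, and the word \<open>ws\<close>
  itself shows that it is the only candidate, so the definite description in \<open>reach\<close> is
  meaningful.\<close>

lemma reach_word_prod:
  assumes "reduced_automaton W S A" "ws \<in> reduced_words W S"
  shows "reach W S A (word_prod W ws) = end_state A ws"
proof -
  have "end_state A ws' = end_state A ws"
    if "ws' \<in> reduced_words W S" "word_prod W ws' = word_prod W ws" for ws'
    using assms that unfolding reduced_automaton_def by blast
  then show ?thesis
    unfolding reach_def using assms(2) by (intro the_equality) blast+
qed

lemma end_state_live_iff:
  assumes "reduced_automaton W S A" "ws \<in> lists S"
  shows "end_state A ws \<in> live A \<longleftrightarrow> ws \<in> reduced_words W S"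
  using assms by (auto simp: reduced_automaton_def recognises_reduced_def accepted_words_def)

lemma end_state_Nil [simp]: "end_state A [] = Some (start A)"
  and end_state_snoc [simp]: "end_state A (ws @ [s]) = transition A (end_state A ws) s"
  by (simp_all add: end_state_def)

text \<open>Outside \<open>live A\<close> there are also the values \<open>Some y\<close> for which
  \<open>y\<close> is not a state. They are never attained, so a word that is not accepted ends in
  \<open>None\<close>.\<close>

lemma end_state_in:
  assumes "is_automaton S A" "ws \<in> lists S"
  shows "end_state A ws \<in> live A \<union> {None}"
  using assms(2)
proof (induction ws rule: rev_induct)
  case Nil
  then show ?case using assms(1) by (simp add: is_automaton_def live_def)
next
  case (snoc s ws)
  then show ?case using assms(1) by (auto simp: is_automaton_def)
qed

lemma reach_live:
  assumes "reduced_automaton W S A" "w \<in> carrier W"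
  obtains y where "y \<in> states A" "reach W S A w = Some y"
proof -
  obtain ws where ws: "ws \<in> reduced_words W S" "word_prod W ws = w"
    using assms by (meson ex_reduced_word inv_closed)
  then have "reach W S A w \<in> live A"
    using assms reach_word_prod end_state_live_iff reduced_words_lists by metis
  with that show ?thesis by (auto simp: live_def)
qed

lemma transition_reach:
  assumes A: "reduced_automaton W S A" and "w \<in> carrier W" "s \<in> S"
  shows "transition A (reach W S A (inv w)) s =
    (if s \<in> left_descents W S w then None else reach W S A (inv (s \<otimes> w)))"
proof -
  obtain ws where ws: "ws \<in> reduced_words W S" "word_prod W ws = inv w"
    using assms by (meson ex_reduced_word inv_closed)
  have lists: "ws \<in> lists S" "ws @ [s] \<in> lists S"
    using ws(1) assms(3) by (auto simp: reduced_words_def)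
  have prod: "word_prod W (ws @ [s]) = inv (s \<otimes> w)"
    using ws assms lists by (simp add: word_prod_snoc inv_mult_group generator_inv)
  have snoc: "ws @ [s] \<in> reduced_words W S \<longleftrightarrow> s \<notin> left_descents W S w"
    using reduced_snoc_iff[OF ws(1) assms(3)] ws(2) assms(2) by simp
  have "transition A (reach W S A (inv w)) s = end_state A (ws @ [s])"
    using reach_word_prod[OF A ws(1)] ws(2) by simp
  also have "\<dots> = (if s \<in> left_descents W S w then None else reach W S A (inv (s \<otimes> w)))"
  proof (cases "s \<in> left_descents W S w")
    \<comment> \<open>The extended word is not reduced, hence not accepted, and so it ends in the
      dead state.\<close>
    case True
    then have "end_state A (ws @ [s]) \<notin> live A"
      using end_state_live_iff[OF A lists(2)] snoc by blast
    then show ?thesis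
      using True end_state_in[of A "ws @ [s]"] A lists(2)
      by (simp add: reduced_automaton_def recognises_reduced_def)
  next
    case False
    then show ?thesis
      using reach_word_prod[OF A, of "ws @ [s]"] snoc prod by simp
  qed
  finally show ?thesis .
qed

section \<open>The parts attached to states\<close>

lemma state_part_iff: "w \<in> state_part W S A y \<longleftrightarrow> w \<in> carrier W \<and> reach W S A (inv w) = Some y"
  by (simp add: state_part_def)

lemma transition_state_part:
  assumes "reduced_automaton W S A" "w \<in> state_part W S A y" "s \<in> S"
  shows "transition A (Some y) s =
    (if s \<in> left_descents W S w then None else reach W S A (inv (s \<otimes> w)))"
  using transition_reach[of A w s] assms by (simp add: state_part_iff)

text \<open>\<open>reach\<close> never yields \<open>None\<close> on a group element, so a dead
  transition can only come from a descent. The right-hand side involves \<open>y\<close> but not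
  \<open>w\<close>, which makes the descent set constant on a part.\<close>

lemma left_descents_state_part:
  assumes "reduced_automaton W S A" "w \<in> state_part W S A y"
  shows "left_descents W S w = {s \<in> S. transition A (Some y) s = None}"
proof -
  have "s \<in> left_descents W S w \<longleftrightarrow> transition A (Some y) s = None" if "s \<in> S" for s
  proof -
    have "s \<otimes> w \<in> carrier W"
      using assms that by (auto simp: state_part_iff)
    then obtain z where "reach W S A (inv (s \<otimes> w)) = Some z"
      using reach_live[OF assms(1)] inv_closed by metis
    then show ?thesis
      using transition_state_part[OF assms that] by simp
  qed
  moreover have "left_descents W S w \<subseteq> S"
    by (auto simp: left_descents_def)
  ultimately show ?thesis by blast
qed

lemma part_descents_eq:
  assumes "\<And>v. v \<in> R \<Longrightarrow> left_descents W S v = D" "R \<noteq> {}"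
  shows "part_descents W S R = D"
proof -
  have "left_descents W S ` R = {D}"
    using assms by blast
  then show ?thesis by (simp add: part_descents_def)
qed

lemma part_descents_state_part:
  assumes "reduced_automaton W S A" "state_part W S A y \<noteq> {}"
  shows "part_descents W S (state_part W S A y) = {s \<in> S. transition A (Some y) s = None}"
  using left_descents_state_part[OF assms(1)] assms(2) by (rule part_descents_eq)

text \<open>From right to left a single element of the part decides the transition; for an empty
  part the inclusion would be vacuous. The right-hand side refers to the automaton only through its
  parts, so it can be compared between two automata.\<close>

lemma transition_iff_l_coset:
  assumes A: "reduced_automaton W S A" and nonempty: "state_part W S A x \<noteq> {}" and "s \<in> S"
  shows "transition A (Some x) s = Some y \<longleftrightarrow>
    s \<notin> part_descents W S (state_part W S A x) \<and> s <# state_part W S A x \<subseteq> state_part W S A y"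
proof
  assume trans: "transition A (Some x) s = Some y"
  have "s \<otimes> w \<in> state_part W S A y" if w: "w \<in> state_part W S A x" for w
    using transition_state_part[OF A w \<open>s \<in> S\<close>] trans w \<open>s \<in> S\<close>
    by (auto simp: state_part_iff split: if_splits)
  then show "s \<notin> part_descents W S (state_part W S A x) \<and>
      s <# state_part W S A x \<subseteq> state_part W S A y"
    using trans part_descents_state_part[OF A nonempty] by (auto simp: l_coset_def)
next
  assume rhs: "s \<notin> part_descents W S (state_part W S A x) \<and>
    s <# state_part W S A x \<subseteq> state_part W S A y"
  obtain w where w: "w \<in> state_part W S A x"
    using nonempty by blast
  then have "s \<otimes> w \<in> state_part W S A y"
    using rhs by (auto simp: l_coset_def)
  moreover have "s \<notin> left_descents W S w"
    using rhs part_descents_state_part[OF A nonempty] left_descents_state_part[OF A w] by simp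
  ultimately show "transition A (Some x) s = Some y"
    using transition_state_part[OF A w \<open>s \<in> S\<close>] by (simp add: state_part_iff)
qed

lemma mem_partition_of_automaton:
  "R \<in> partition_of_automaton W S A \<longleftrightarrow> (\<exists>y \<in> states A. R = state_part W S A y)"
  by (auto simp: partition_of_automaton_def)

text \<open>The parts are fibres of the map sending \<open>w\<close> to
  \<open>reach W S A (inv w)\<close>, hence disjoint and covering. States that no word reaches have
  an empty fibre, which is why \<open>{}\<close> is removed.\<close>

lemma regular_partition_of_automaton:
  assumes A: "reduced_automaton W S A"
  shows "regular_partition W S (partition_of_automaton W S A - {{}})"
    (is "regular_partition W S ?P")
  unfolding regular_partition_def
proof (intro conjI ballI)
  show "partition_on (carrier W) ?P"
  proof (rule partition_onI)
    have "w \<in> \<Union>?P" if w: "w \<in> carrier W" for w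
    proof -
      obtain y where "y \<in> states A" "reach W S A (inv w) = Some y"
        using reach_live[OF A inv_closed[OF w]] .
      with w have "state_part W S A y \<in> ?P" "w \<in> state_part W S A y"
        by (auto simp: mem_partition_of_automaton state_part_iff)
      then show ?thesis by blast
    qed
    then show "\<Union>?P = carrier W"
      by (auto simp: mem_partition_of_automaton state_part_iff)
  qed (auto simp: mem_partition_of_automaton state_part_iff disjnt_iff)
next
  fix R v w assume "R \<in> ?P" "v \<in> R" "w \<in> R"
  then show "left_descents W S v = left_descents W S w"
    using left_descents_state_part[OF A] by (auto simp: mem_partition_of_automaton)
next
  fix R s assume "R \<in> ?P" and s: "s \<in> S - part_descents W S R"
  then obtain x where x: "x \<in> states A" "R = state_part W S A x" "state_part W S A x \<noteq> {}"
    by (auto simp: mem_partition_of_automaton)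
  have "transition A (Some x) s \<noteq> None"
    using s part_descents_state_part[OF A x(3)] x by auto
  moreover have "transition A (Some x) s \<in> live A \<union> {None}"
    using A x(1) s
    by (auto simp: reduced_automaton_def recognises_reduced_def is_automaton_def live_def)
  ultimately obtain y where y: "y \<in> states A" "transition A (Some x) s = Some y"
    by (auto simp: live_def)
  have "s <# state_part W S A x \<subseteq> state_part W S A y"
    using transition_iff_l_coset[OF A x(3), of s y] s y by simp
  \<comment> \<open>The target part contains a nonempty set, so it is not the removed
    \<open>{}\<close>.\<close>
  moreover have "s <# state_part W S A x \<noteq> {}"
    using x(3) by (auto simp: l_coset_def)
  moreover have "state_part W S A y \<in> partition_of_automaton W S A"
    using y(1) mem_partition_of_automaton by blast
  ultimately show "\<exists>R' \<in> ?P. s <# R \<subseteq> R'"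
    using x(2) by blast
qed

text \<open>A word ending in a state is accepted, hence reduced, and the inverse of its product lies
  in the part of that state.\<close>

lemma state_part_nonempty:
  assumes A: "reduced_automaton W S A" and "accessible S A" "y \<in> states A"
  shows "state_part W S A y \<noteq> {}"
proof -
  obtain ws where ws: "ws \<in> lists S" "end_state A ws = Some y"
    using assms by (auto simp: accessible_def)
  then have "ws \<in> reduced_words W S"
    using end_state_live_iff[OF A ws(1)] assms(3) by (simp add: live_def)
  then have "inv (word_prod W ws) \<in> state_part W S A y"
    using ws reach_word_prod[OF A] by (simp add: state_part_iff)
  then show ?thesis by blast
qed

lemma regular_partition_of_accessible:
  assumes A: "reduced_automaton W S A" "accessible S A"
  shows "regular_partition W S (partition_of_automaton W S A)"
proof -
  have "{} \<notin> partition_of_automaton W S A"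
    using state_part_nonempty[OF A] by (auto simp: mem_partition_of_automaton)
  then show ?thesis
    using regular_partition_of_automaton[OF A(1)] by simp
qed

section \<open>The automaton of a regular partition\<close>

lemma regular_partitionD:
  assumes "regular_partition W S P"
  shows "\<Union>P = carrier W" "disjoint P" "{} \<notin> P"
  using assms by (simp_all add: regular_partition_def partition_on_def)

lemma regular_partition_nonempty:
  assumes P: "regular_partition W S P" and R: "R \<in> P"
  obtains w where "w \<in> R" "w \<in> carrier W"
proof -
  have "R \<noteq> {}" "R \<subseteq> carrier W"
    using regular_partitionD(1,3)[OF P] R by (blast, blast)
  with that show ?thesis by blast
qed

lemma left_descents_regular:
  assumes "regular_partition W S P" "R \<in> P" "v \<in> R" "w \<in> R"
  shows "left_descents W S v = left_descents W S w"
  using assms unfolding regular_partition_def by blast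

lemma regular_partition_unique_part:
  assumes "regular_partition W S P" "R \<in> P" "R' \<in> P" "w \<in> R" "w \<in> R'"
  shows "R = R'"
  using assms(2-) disjointD[OF regular_partitionD(2)[OF assms(1)], of R R'] by blast

lemma part_descents_regular:
  assumes "regular_partition W S P" "R \<in> P" "w \<in> R"
  shows "part_descents W S R = left_descents W S w"
proof (rule part_descents_eq)
  show "left_descents W S v = left_descents W S w" if "v \<in> R" for v
    using left_descents_regular[OF assms(1,2) that assms(3)] .
qed (use assms(3) in blast)

text \<open>The identity is the only element without left descents, and descents are constant on
  parts. This makes the start state of \<open>automaton_of_partition\<close> a genuine
  state.\<close>

lemma part_of_one:
  assumes P: "regular_partition W S P"
  shows "{\<one>} \<in> P"
proof -
  note carrier = regular_partitionD(1)[OF P]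
  then obtain R where R: "R \<in> P" "\<one> \<in> R"
    using one_closed by blast
  have "w = \<one>" if "w \<in> R" for w
  proof -
    have "left_descents W S w = left_descents W S \<one>"
      using left_descents_regular[OF P R(1) that R(2)] .
    moreover have "w \<in> carrier W"
      using carrier R(1) that by blast
    ultimately show ?thesis
      using left_descents_empty_iff one_closed by metis
  qed
  with R have "R = {\<one>}" by blast
  with R show ?thesis by simp
qed

text \<open>One representative \<open>w\<close> of \<open>R\<close> determines the transition: its
  descents are those of \<open>R\<close>, and by disjointness the part containing \<open>s\<close>
  times \<open>w\<close> is the only one that can contain the translate of \<open>R\<close>.\<close>

lemma transition_automaton_of_partition:
  assumes P: "regular_partition W S P" and R: "R \<in> P" "w \<in> R" and "s \<in> S"
    and R': "R' \<in> P" "s \<otimes> w \<in> R'"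
  shows "transition (automaton_of_partition W S P) (Some R) s =
    (if s \<in> left_descents W S w then None else Some R')"
proof (cases "s \<in> left_descents W S w")
  case False
  then have "s \<in> S - part_descents W S R"
    using \<open>s \<in> S\<close> part_descents_regular[OF P R] by simp
  moreover have "\<forall>R \<in> P. \<forall>s \<in> S - part_descents W S R. \<exists>R' \<in> P. s <# R \<subseteq> R'"
    using P by (simp add: regular_partition_def)
  ultimately obtain Q where Q: "Q \<in> P" "s <# R \<subseteq> Q"
    using R(1) by blast
  have mem: "s \<otimes> w \<in> s <# R"
    using R(2) by (auto simp: l_coset_def)
  then have "Q = R'"
    using Q R' regular_partition_unique_part[OF P] by blast
  moreover have "(THE R'. R' \<in> P \<and> s <# R \<subseteq> R') = Q"
    using Q mem regular_partition_unique_part[OF P] by (intro the_equality) blast+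
  ultimately show ?thesis
    using False part_descents_regular[OF P R] by (simp add: automaton_of_partition_def)
qed (use part_descents_regular[OF P R] in \<open>simp add: automaton_of_partition_def\<close>)

lemma part_exists:
  assumes "regular_partition W S P" "w \<in> carrier W"
  obtains R where "R \<in> P" "w \<in> R"
  using assms(2) regular_partitionD(1)[OF assms(1)] by blast

lemma is_automaton_of_partition:
  assumes P: "regular_partition W S P"
  shows "is_automaton S (automaton_of_partition W S P)" (is "is_automaton S ?A")
  unfolding is_automaton_def
proof (intro conjI ballI)
  show "start ?A \<in> states ?A"
    using part_of_one[OF P] by (simp add: automaton_of_partition_def)
next
  fix q s assume q: "q \<in> live ?A \<union> {None}" and s: "s \<in> S"
  show "transition ?A q s \<in> live ?A \<union> {None}"
  proof (cases q)
    case None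
    then show ?thesis by (simp add: automaton_of_partition_def)
  next
    case (Some R)
    then have R: "R \<in> P"
      using q by (auto simp: live_def automaton_of_partition_def)
    then obtain w where w: "w \<in> R" "w \<in> carrier W"
      using regular_partition_nonempty[OF P] by metis
    then obtain R' where "R' \<in> P" "s \<otimes> w \<in> R'"
      using part_exists[OF P] s m_closed generator_closed by metis
    with transition_automaton_of_partition[OF P R w(1) s] Some show ?thesis
      by (auto simp: live_def automaton_of_partition_def)
  qed
qed (simp add: automaton_of_partition_def)

text \<open>The invariant while reading a word: as long as it is reduced, the current part contains
  the inverse of its product. Appending \<open>s\<close> multiplies this inverse by \<open>s\<close>
  on the left, and the run dies exactly when \<open>s\<close> is a descent of it.\<close>

lemma end_state_automaton_of_partition:
  assumes P: "regular_partition W S P" and "ws \<in> lists S"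
  shows "if ws \<in> reduced_words W S
    then \<exists>R \<in> P. inv (word_prod W ws) \<in> R \<and> end_state (automaton_of_partition W S P) ws = Some R
    else end_state (automaton_of_partition W S P) ws = None"
  using assms(2)
proof (induction ws rule: rev_induct)
  case Nil
  then show ?case
    using part_of_one[OF P] by (auto simp: automaton_of_partition_def)
next
  case (snoc s ws)
  then have ws: "ws \<in> lists S" "s \<in> S" by auto
  show ?case
  proof (cases "ws \<in> reduced_words W S")
    case True
    then obtain R where R: "R \<in> P" "inv (word_prod W ws) \<in> R"
      "end_state (automaton_of_partition W S P) ws = Some R"
      using snoc.IH[OF ws(1)] by auto
    obtain R' where R': "R' \<in> P" "s \<otimes> inv (word_prod W ws) \<in> R'"
      using part_exists[OF P] ws m_closed inv_closed generator_closed word_prod_closed by metis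
    show ?thesis
      using transition_automaton_of_partition[OF P R(1,2) ws(2) R'] R(3) R'
        reduced_snoc_iff[OF True ws(2)] inv_word_prod_snoc[OF ws] by auto
  next
    \<comment> \<open>An extension of a non-reduced word is not reduced, and the dead state is
      absorbing.\<close>
    case False
    then have "ws @ [s] \<notin> reduced_words W S"
      using reduced_snocD by blast
    moreover have "end_state (automaton_of_partition W S P) ws = None"
      using snoc.IH[OF ws(1)] False by simp
    ultimately show ?thesis by (simp add: automaton_of_partition_def)
  qed
qed

lemma end_state_automaton_of_partition_eq:
  assumes P: "regular_partition W S P" and "ws \<in> reduced_words W S"
    and "R \<in> P" "inv (word_prod W ws) \<in> R"
  shows "end_state (automaton_of_partition W S P) ws = Some R"
  using end_state_automaton_of_partition[OF P reduced_words_lists[OF assms(2)]] assms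
    regular_partition_unique_part[OF P] by auto

lemma automaton_of_partition_reduced:
  assumes P: "regular_partition W S P"
  shows "automaton_of_partition W S P \<in> reduced_automata W S" (is "?A \<in> _")
proof -
  have states: "states ?A = P"
    by (simp add: automaton_of_partition_def)
  have "accepted_words S ?A = reduced_words W S"
  proof -
    have "end_state ?A ws \<in> live ?A \<longleftrightarrow> ws \<in> reduced_words W S" if "ws \<in> lists S" for ws
      using end_state_automaton_of_partition[OF P that] states
      by (auto simp: live_def split: if_splits)
    then show ?thesis
      using reduced_words_lists by (auto simp: accepted_words_def)
  qed
  moreover have "end_state ?A ws = end_state ?A ws'"
    if ws: "ws \<in> reduced_words W S" "ws' \<in> reduced_words W S" "word_prod W ws = word_prod W ws'"
    for ws ws'
  proof -
    obtain R where "R \<in> P" "inv (word_prod W ws) \<in> R"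
      using part_exists[OF P] reduced_words_lists[OF ws(1)] inv_closed word_prod_closed by metis
    then show ?thesis
      using end_state_automaton_of_partition_eq[OF P] ws by metis
  qed
  moreover have "accessible S ?A"
    unfolding accessible_def states
  proof
    fix R assume R: "R \<in> P"
    then obtain w where w: "w \<in> R" "w \<in> carrier W"
      using regular_partition_nonempty[OF P] by metis
    then obtain ws where "ws \<in> reduced_words W S" "word_prod W ws = inv w"
      by (meson ex_reduced_word inv_closed)
    then show "\<exists>ws \<in> lists S. end_state ?A ws = Some R"
      using end_state_automaton_of_partition_eq[OF P _ R] w reduced_words_lists by fastforce
  qed
  ultimately show ?thesis
    using is_automaton_of_partition[OF P]
    unfolding reduced_automata_def reduced_automaton_def recognises_reduced_def by blast
qed

text \<open>A reduced word for \<open>inv w\<close> leads to the part containing \<open>w\<close>,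
  by the invariant on end states. So passing to the automaton and back recovers each part.\<close>

lemma state_part_automaton_of_partition:
  assumes P: "regular_partition W S P" and R: "R \<in> P"
  shows "state_part W S (automaton_of_partition W S P) R = R" (is "state_part W S ?A R = R")
proof -
  have A: "reduced_automaton W S ?A"
    using automaton_of_partition_reduced[OF P] by (simp add: reduced_automata_def)
  have "reach W S ?A (inv w) = Some R \<longleftrightarrow> w \<in> R" if w: "w \<in> carrier W" for w
  proof -
    obtain ws where ws: "ws \<in> reduced_words W S" "word_prod W ws = inv w"
      using w by (meson ex_reduced_word inv_closed)
    obtain R' where R': "R' \<in> P" "w \<in> R'"
      using part_exists[OF P w] .
    have "reach W S ?A (inv w) = Some R'"
      using reach_word_prod[OF A ws(1)] end_state_automaton_of_partition_eq[OF P ws(1) R'(1)]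
        ws(2) R'(2) w by simp
    then show ?thesis
      using R R' regular_partition_unique_part[OF P] by auto
  qed
  moreover have "R \<subseteq> carrier W"
    using regular_partitionD(1)[OF P] R by blast
  ultimately show ?thesis by (auto simp: state_part_iff)
qed

lemma partition_of_automaton_of_partition:
  assumes "regular_partition W S P"
  shows "partition_of_automaton W S (automaton_of_partition W S P) = P"
  using state_part_automaton_of_partition[OF assms]
  by (auto simp: mem_partition_of_automaton automaton_of_partition_def)

end

section \<open>Isomorphisms and partitions\<close>

lemma transition_closed:
  assumes "is_automaton S A" "q \<in> live A \<union> {None}" "s \<in> S"
  shows "transition A q s \<in> live A \<union> {None}"
  using assms by (auto simp: is_automaton_def)

lemma reduced_automataD:
  assumes "A \<in> reduced_automata W S"
  shows "reduced_automaton W S A" "accessible S A" "start A \<in> states A"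
proof -
  show "reduced_automaton W S A" and "accessible S A"
    using assms unfolding reduced_automata_def by blast+
  then have "is_automaton S A"
    unfolding reduced_automaton_def recognises_reduced_def by blast
  then show "start A \<in> states A"
    by (simp add: is_automaton_def)
qed

lemma automaton_iso_map_states:
  assumes "automaton_iso_map S A B f"
  shows "x \<in> states A \<Longrightarrow> \<exists>y \<in> states B. f (Some x) = Some y"
    and "y \<in> states B \<Longrightarrow> \<exists>x \<in> states A. f (Some x) = Some y"
proof -
  have f_live: "f ` live A = live B"
    using assms by (simp add: automaton_iso_map_def)
  show "\<exists>y \<in> states B. f (Some x) = Some y" if "x \<in> states A"
  proof -
    have "f (Some x) \<in> live B"
      unfolding f_live[symmetric] using that by (simp add: live_def)
    then show ?thesis by (auto simp: live_def)
  qed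
  show "\<exists>x \<in> states A. f (Some x) = Some y" if "y \<in> states B"
  proof -
    have "Some y \<in> f ` live A"
      unfolding f_live using that by (simp add: live_def)
    then show ?thesis by (auto simp: live_def)
  qed
qed

text \<open>The definition of an isomorphism speaks only of edges between live states. A dead
  transition of \<open>A\<close> stays dead in \<open>B\<close>: a live edge of \<open>B\<close> out
  of \<open>f q\<close> would lift to a live edge of \<open>A\<close> whose source is
  \<open>q\<close> by injectivity.\<close>

lemma automaton_iso_map_transition:
  assumes A: "is_automaton S A" and B: "is_automaton S B" and f: "automaton_iso_map S A B f"
    and q: "q \<in> live A \<union> {None}" and s: "s \<in> S"
  shows "transition B (f q) s = f (transition A q s)"
proof -
  have fNone: "f None = None" and f_live: "f ` live A = live B" and inj: "inj_on f (live A)"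
    using f by (simp_all add: automaton_iso_map_def)
  show ?thesis
  proof (cases "q = None")
    case True
    then show ?thesis using A B s fNone by (simp add: is_automaton_def)
  next
    case False
    then have q': "q \<in> live A" using q by blast
    show ?thesis
    proof (cases "transition A q s = None")
      case True
      have "transition B (f q) s \<in> live B \<union> {None}"
        using transition_closed[OF B _ s] q' f_live by blast
      moreover have "transition B (f q) s \<notin> live B"
      proof
        assume "transition B (f q) s \<in> live B"
        then obtain x where "x \<in> live A" "f x = f q" "transition A x s \<in> live A"
          using f s q' f_live unfolding automaton_iso_map_def by (metis imageI)
        then have "transition A q s \<in> live A"
          using inj_onD[OF inj _ _ q'] by metis
        then show False
          using True by (simp add: live_def image_iff)
      qed
      ultimately show ?thesis using True fNone by auto
    next
      case False
      then have "transition A q s \<in> live A"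
        using transition_closed[OF A q s] by auto
      then show ?thesis
        using f q' s unfolding automaton_iso_map_def by blast
    qed
  qed
qed

context involution_generated_group
begin

lemma automaton_iso_map_end_state:
  assumes A: "is_automaton S A" and B: "is_automaton S B" and f: "automaton_iso_map S A B f"
    and "ws \<in> lists S"
  shows "end_state B ws = f (end_state A ws)"
  using assms(4)
proof (induction ws rule: rev_induct)
  case Nil
  then show ?case using f by (simp add: automaton_iso_map_def)
next
  case (snoc s ws)
  then show ?case
    using automaton_iso_map_transition[OF A B f end_state_in[OF A]] by simp
qed

lemma isomorphic_reduced_automata:
  assumes A: "A \<in> reduced_automata W S" and B: "is_automaton S B" and f: "automaton_iso_map S A B f"
  shows "B \<in> reduced_automata W S"
proof -
  have A': "is_automaton S A" "accepted_words S A = reduced_words W S" "accessible S A"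
    "reduced_automaton W S A"
    using A unfolding reduced_automata_def reduced_automaton_def recognises_reduced_def by blast+
  note end_B = automaton_iso_map_end_state[OF A'(1) B f]
  have f_live: "f ` live A = live B" and fNone: "f None = None"
    using f by (auto simp: automaton_iso_map_def)
  have "end_state B ws \<in> live B \<longleftrightarrow> end_state A ws \<in> live A" if "ws \<in> lists S" for ws
    using end_B[OF that] end_state_in[OF A'(1) that] f_live fNone by (auto simp: live_def)
  then have "accepted_words S B = reduced_words W S"
    unfolding A'(2)[symmetric] by (auto simp: accepted_words_def)
  moreover have "accessible S B"
    unfolding accessible_def
  proof
    fix y assume "y \<in> states B"
    then obtain x where "x \<in> states A" "f (Some x) = Some y"
      using automaton_iso_map_states(2)[OF f] by blast
    moreover from this obtain ws where "ws \<in> lists S" "end_state A ws = Some x"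
      using A'(3) by (auto simp: accessible_def)
    ultimately show "\<exists>ws \<in> lists S. end_state B ws = Some y"
      using end_B by metis
  qed
  moreover have "\<forall>ws \<in> reduced_words W S. \<forall>ws' \<in> reduced_words W S.
      word_prod W ws = word_prod W ws' \<longrightarrow> end_state B ws = end_state B ws'"
    using A'(4) end_B reduced_words_lists unfolding reduced_automaton_def by metis
  ultimately show ?thesis
    using B unfolding reduced_automata_def reduced_automaton_def recognises_reduced_def by blast
qed

text \<open>An isomorphism carries the end state of each word in \<open>A\<close> to its end state
  in \<open>B\<close>, so it commutes with \<open>reach\<close>; being injective on live states, it
  preserves the fibres.\<close>

lemma isomorphic_partition_eq:
  assumes A: "reduced_automaton W S A" and B: "reduced_automaton W S B"
    and f: "automaton_iso_map S A B f"
  shows "partition_of_automaton W S A = partition_of_automaton W S B"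
proof -
  have inj: "inj_on f (live A)"
    using f by (simp add: automaton_iso_map_def)
  have aut: "is_automaton S A" "is_automaton S B"
    using A B unfolding reduced_automaton_def recognises_reduced_def by blast+
  have reach: "reach W S B w = f (reach W S A w)" if w: "w \<in> carrier W" for w
  proof -
    obtain ws where ws: "ws \<in> reduced_words W S" "word_prod W ws = w"
      using w by (meson ex_reduced_word inv_closed)
    then show ?thesis
      using reach_word_prod[OF A ws(1)] reach_word_prod[OF B ws(1)]
        automaton_iso_map_end_state[OF aut f reduced_words_lists] by simp
  qed
  have part: "state_part W S A x = state_part W S B y"
    if x: "x \<in> states A" and y: "f (Some x) = Some y" for x y
  proof -
    have "reach W S A (inv w) = Some x \<longleftrightarrow> reach W S B (inv w) = Some y"
      if w: "w \<in> carrier W" for w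
    proof -
      \<comment> \<open>Injectivity of \<open>f\<close> is available only on live states, so the
        reached state must be known to be live.\<close>
      obtain z where "z \<in> states A" "reach W S A (inv w) = Some z"
        using reach_live[OF A inv_closed[OF w]] .
      then show ?thesis
        using reach[of "inv w"] w x y inj by (auto simp: inj_on_def live_def)
    qed
    then show ?thesis by (auto simp: state_part_iff)
  qed
  show ?thesis
  proof (intro equalityI subsetI)
    fix R assume "R \<in> partition_of_automaton W S A"
    then show "R \<in> partition_of_automaton W S B"
      using automaton_iso_map_states(1)[OF f] part unfolding mem_partition_of_automaton by metis
  next
    fix R assume "R \<in> partition_of_automaton W S B"
    then show "R \<in> partition_of_automaton W S A"
      using automaton_iso_map_states(2)[OF f] part unfolding mem_partition_of_automaton by metis
  qed
qed

lemma state_part_inj: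
  assumes "reduced_automaton W S A" "accessible S A" "x \<in> states A"
    and "state_part W S A x = state_part W S A y"
  shows "x = y"
proof -
  obtain w where w: "w \<in> state_part W S A x"
    using state_part_nonempty[OF assms(1-3)] by blast
  moreover have "w \<in> state_part W S A y"
    using w assms(4) by simp
  ultimately show ?thesis by (simp add: state_part_iff)
qed

lemma one_in_state_part_start:
  assumes "reduced_automaton W S A"
  shows "\<one> \<in> state_part W S A (start A)"
  using reach_word_prod[OF assms Nil_reduced] by (simp add: state_part_iff)

text \<open>In an accessible reduced automaton distinct states have distinct parts, so matching
  equal parts is a bijection \<open>g\<close> of states. Transitions correspond because both sides
  are described by the same condition on parts.\<close>

lemma isomorphic_if_partition_eq:
  assumes A: "A \<in> reduced_automata W S" and B: "B \<in> reduced_automata W S"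
    and eq: "partition_of_automaton W S A = partition_of_automaton W S B"
  shows "isomorphic_automata S A B"
proof -
  have A': "reduced_automaton W S A" "accessible S A" "start A \<in> states A"
    and B': "reduced_automaton W S B" "accessible S B" "start B \<in> states B"
    using reduced_automataD[OF A] reduced_automataD[OF B] by simp_all
  have "\<forall>x \<in> states A. \<exists>y \<in> states B. state_part W S A x = state_part W S B y"
    using eq mem_partition_of_automaton by metis
  then obtain g where g: "g x \<in> states B" "state_part W S A x = state_part W S B (g x)"
    if "x \<in> states A" for x
    by metis
  have g_iff: "g x = y \<longleftrightarrow> state_part W S A x = state_part W S B y" if "x \<in> states A" for x y
    using g[OF that] state_part_inj[OF B'(1,2)] by metis
  have surj: "\<exists>x \<in> states A. g x = y" if y: "y \<in> states B" for y
  proof -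
    obtain x where "x \<in> states A" "state_part W S A x = state_part W S B y"
      using eq y mem_partition_of_automaton by metis
    with g_iff show ?thesis by blast
  qed
  have g_image: "g ` states A = states B"
    using g(1) surj by blast
  have inj: "inj_on g (states A)"
    using g(2) state_part_inj[OF A'(1,2)] by (metis inj_onI)
  \<comment> \<open>The start state is recognised as the unique state whose part contains the
    identity.\<close>
  have "\<one> \<in> state_part W S B (g (start A))"
    using one_in_state_part_start[OF A'(1)] g(2)[OF A'(3)] by simp
  then have start: "g (start A) = start B"
    using one_in_state_part_start[OF B'(1)] by (simp add: state_part_iff)
  have trans: "transition A (Some x) s = Some y \<longleftrightarrow> transition B (Some (g x)) s = Some (g y)"
    if xy: "x \<in> states A" "y \<in> states A" and s: "s \<in> S" for x y s
    using transition_iff_l_coset[OF A'(1) state_part_nonempty[OF A'(1,2) xy(1)] s]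
      transition_iff_l_coset[OF B'(1) state_part_nonempty[OF B'(1,2) g(1)[OF xy(1)]] s]
      g(2)[OF xy(1)] g(2)[OF xy(2)] by simp
  have "automaton_iso_map S A B (map_option g)"
    unfolding automaton_iso_map_def
  proof (intro conjI ballI impI)
    show "inj_on (map_option g) (live A)"
      using inj by (auto simp: inj_on_def live_def)
    show "map_option g ` live A = live B"
      unfolding live_def g_image[symmetric] by (simp add: image_image)
  next
    fix x y s assume "x \<in> live A" "y \<in> live A" "s \<in> S" "transition A x s = y"
    then show "transition B (map_option g x) s = map_option g y"
      using trans by (force simp: live_def)
  next
    fix x' y' s assume "x' \<in> live B" "y' \<in> live B" and s: "s \<in> S" "transition B x' s = y'"
    then obtain x y where "x \<in> states A" "y \<in> states A" "x' = Some (g x)" "y' = Some (g y)"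
      using surj unfolding live_def by blast
    with s trans show "\<exists>x \<in> live A. \<exists>y \<in> live A.
        map_option g x = x' \<and> map_option g y = y' \<and> transition A x s = y"
      by (auto simp: live_def)
  qed (simp_all add: start)
  then show ?thesis by (auto simp: isomorphic_automata_def)
qed

lemma isomorphic_automata_iff:
  assumes "A \<in> reduced_automata W S" "B \<in> reduced_automata W S"
  shows "isomorphic_automata S A B \<longleftrightarrow> partition_of_automaton W S A = partition_of_automaton W S B"
  using isomorphic_if_partition_eq[OF assms]
    isomorphic_partition_eq[OF reduced_automataD(1)[OF assms(1)] reduced_automataD(1)[OF assms(2)]]
  unfolding isomorphic_automata_def by blast

lemma class_of_partition_eq:
  assumes "regular_partition W S P"
  shows "class_of_partition W S P = {A \<in> reduced_automata W S. partition_of_automaton W S A = P}"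
  using isomorphic_automata_iff[OF automaton_of_partition_reduced[OF assms]]
    partition_of_automaton_of_partition[OF assms]
  by (auto simp: class_of_partition_def)

end

section \<open>Renaming states into another type\<close>

text \<open>The states of \<open>automaton_of_partition\<close> are sets of group elements, whereas
  classes consist of automata over \<open>'q\<close>. A new state is pulled back by
  \<open>inv_into\<close>, so the behaviour is as intended when \<open>k\<close> is injective on the
  states.\<close>

definition rename_states :: "('q \<Rightarrow> 'r) \<Rightarrow> ('q, 'a) automaton \<Rightarrow> ('r, 'a) automaton" where
  "rename_states k A =
     \<lparr> states = k ` states A,
       transition = (\<lambda>q s. map_option k (transition A (map_option (inv_into (states A) k) q) s)),
       start = k (start A) \<rparr>"

lemma rename_states_simps [simp]:
  "states (rename_states k A) = k ` states A"
  "start (rename_states k A) = k (start A)"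
  "live (rename_states k A) = map_option k ` live A"
  by (simp_all add: rename_states_def live_def image_image)

lemma transition_rename_states:
  assumes "inj_on k (states A)" "q \<in> live A \<union> {None}"
  shows "transition (rename_states k A) (map_option k q) s = map_option k (transition A q s)"
  using assms by (auto simp: rename_states_def live_def)

lemma rename_states_iso:
  assumes A: "is_automaton S A" and k: "inj_on k (states A)"
  shows "is_automaton S (rename_states k A)"
    and "automaton_iso_map S A (rename_states k A) (map_option k)"
proof -
  note trans = transition_rename_states[OF k]
  have inj: "inj_on (map_option k) (live A)"
    using k by (auto simp: inj_on_def live_def)
  note trans_closed = transition_closed[OF A]
  show "is_automaton S (rename_states k A)"
    unfolding is_automaton_def
  proof (intro conjI ballI)
    fix q s assume "q \<in> live (rename_states k A) \<union> {None}" and s: "s \<in> S"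
    then obtain p where p: "p \<in> live A \<union> {None}" "q = map_option k p"
      by auto
    then show "transition (rename_states k A) q s \<in> live (rename_states k A) \<union> {None}"
      using trans[OF p(1), of s] trans_closed[OF p(1) s] by auto
  next
    fix s assume "s \<in> S"
    then show "transition (rename_states k A) None s = None"
      using trans[of None s] A by (simp add: is_automaton_def)
  qed (use A in \<open>simp add: is_automaton_def\<close>)
  show "automaton_iso_map S A (rename_states k A) (map_option k)"
    unfolding automaton_iso_map_def
  proof (intro conjI ballI impI)
    fix x' y' s
    assume "x' \<in> live (rename_states k A)" and y': "y' \<in> live (rename_states k A)" and s: "s \<in> S"
      and eq: "transition (rename_states k A) x' s = y'"
    then obtain x where x: "x \<in> live A" "x' = map_option k x" by auto
    then have "y' = map_option k (transition A x s)"
      using trans[of x s] eq by simp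
    moreover from this have "transition A x s \<in> live A"
      using trans_closed[of x s] x s y' by (auto simp: live_def)
    ultimately show "\<exists>x \<in> live A. \<exists>y \<in> live A.
        map_option k x = x' \<and> map_option k y = y' \<and> transition A x s = y"
      using x by blast
  qed (use inj trans in auto)
qed

context involution_generated_group
begin

text \<open>There are at most as many parts as group elements, so an injection of the group into
  \<open>'q\<close> leaves room for all states: each part is named by the image of a chosen
  element.\<close>

lemma ex_automaton_with_partition:
  fixes h :: "'w \<Rightarrow> 'q"
  assumes P: "regular_partition W S P" and h: "inj_on h (carrier W)"
  obtains A :: "('q, 'w) automaton"
    where "A \<in> reduced_automata W S" "partition_of_automaton W S A = P"
proof -
  let ?A = "automaton_of_partition W S P"
  let ?k = "\<lambda>R. h (SOME w. w \<in> R)"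
  have pick: "(SOME w. w \<in> R) \<in> R" "R \<subseteq> carrier W" if "R \<in> P" for R
    using that regular_partitionD(1,3)[OF P] by (metis some_in_eq, blast)
  \<comment> \<open>Parts with the same name share their chosen element, hence coincide.\<close>
  have "inj_on ?k P"
    using pick regular_partition_unique_part[OF P] by (intro inj_onI) (metis h inj_onD subsetD)
  then have k: "inj_on ?k (states ?A)"
    by (simp add: automaton_of_partition_def)
  note iso = rename_states_iso[OF is_automaton_of_partition[OF P] k]
  note A = automaton_of_partition_reduced[OF P]
  have B: "rename_states ?k ?A \<in> reduced_automata W S"
    by (rule isomorphic_reduced_automata[OF A iso])
  have "partition_of_automaton W S ?A = partition_of_automaton W S (rename_states ?k ?A)"
    using iso(2) isomorphic_automata_iff[OF A B] by (auto simp: isomorphic_automata_def)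
  with that[OF B] show ?thesis
    using partition_of_automaton_of_partition[OF P] by simp
qed

section \<open>Isomorphism classes and the mutually inverse bijections\<close>

text \<open>On accessible reduced automata isomorphism means equality of partitions, so the
  isomorphism classes are the nonempty fibres of \<open>partition_of_automaton\<close>.\<close>

lemma reduced_automata_classes_eq:
  "(reduced_automata_classes W S :: ('q, 'w) automaton set set) =
    (\<lambda>P. {A \<in> reduced_automata W S. partition_of_automaton W S A = P}) `
      partition_of_automaton W S ` (reduced_automata W S :: ('q, 'w) automaton set)"
proof -
  have "{(A, B). A \<in> reduced_automata W S \<and> B \<in> reduced_automata W S \<and> isomorphic_automata S A B} `` {A} =
      {B \<in> reduced_automata W S. partition_of_automaton W S B = partition_of_automaton W S A}"
    if "A \<in> reduced_automata W S" for A :: "('q, 'w) automaton"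
    using that isomorphic_automata_iff[OF that] by auto
  then show ?thesis
    by (auto simp: reduced_automata_classes_def quotient_def)
qed

text \<open>\<open>F\<close> sends a partition to the fibre of \<open>partition_of_automaton\<close>
  above it, and \<open>G\<close> takes the common value on a fibre. Both are bijective because every
  regular partition has a nonempty fibre.\<close>

lemma bijections:
  fixes h :: "'w \<Rightarrow> 'q"
  assumes h: "inj_on h (carrier W)"
  defines "F \<equiv> (class_of_partition W S :: 'w set set \<Rightarrow> ('q, 'w) automaton set)"
    and "G \<equiv> (partition_of_class W S :: ('q, 'w) automaton set \<Rightarrow> 'w set set)"
    and "Preg \<equiv> regular_partitions W S"
    and "Ared \<equiv> (reduced_automata_classes W S :: ('q, 'w) automaton set set)"
  shows "bij_betw F Preg Ared \<and> bij_betw G Ared Preg \<and>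
    (\<forall>P \<in> Preg. G (F P) = P) \<and> (\<forall>C \<in> Ared. F (G C) = C) \<and>
    (\<forall>C \<in> Ared. \<forall>A \<in> C. G C = partition_of_automaton W S A)"
proof -
  have "partition_of_automaton W S ` (reduced_automata W S :: ('q, 'w) automaton set) = Preg"
  proof
    show "partition_of_automaton W S ` (reduced_automata W S :: ('q, 'w) automaton set) \<subseteq> Preg"
      using regular_partition_of_accessible
      by (auto simp: Preg_def regular_partitions_def reduced_automata_def)
    show "Preg \<subseteq> partition_of_automaton W S ` (reduced_automata W S :: ('q, 'w) automaton set)"
    proof
      fix P assume "P \<in> Preg"
      then obtain A :: "('q, 'w) automaton"
        where "A \<in> reduced_automata W S" "partition_of_automaton W S A = P"
        using ex_automaton_with_partition[OF _ h] by (auto simp: Preg_def regular_partitions_def)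
      then show "P \<in> partition_of_automaton W S ` (reduced_automata W S :: ('q, 'w) automaton set)"
        by blast
    qed
  qed
  moreover have F: "F P = {A \<in> reduced_automata W S. partition_of_automaton W S A = P}"
    if "P \<in> Preg" for P
    using that class_of_partition_eq by (auto simp: F_def Preg_def regular_partitions_def)
  ultimately have Ared: "Ared = F ` Preg"
    unfolding Ared_def reduced_automata_classes_eq by simp
  have GF: "G (F P) = P" if P: "P \<in> Preg" for P
  proof -
    \<comment> \<open>Without a member of the fibre, \<open>the_elem\<close> in
      \<open>partition_of_class\<close> would be applied to the empty set.\<close>
    obtain A :: "('q, 'w) automaton" where "A \<in> F P"
      using ex_automaton_with_partition[OF _ h, of P] P F[OF P]
      by (auto simp: Preg_def regular_partitions_def)
    then have "partition_of_automaton W S ` F P = {P}"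
      using F[OF P] by auto
    then show ?thesis by (simp add: G_def partition_of_class_def)
  qed
  have FG: "F (G C) = C" if "C \<in> Ared" for C
    using that GF Ared by auto
  have "G C = partition_of_automaton W S A" if "C \<in> Ared" "A \<in> C" for C A
    using that GF F Ared by auto
  moreover have "bij_betw F Preg Ared" "bij_betw G Ared Preg"
    using GF FG Ared by (auto intro!: bij_betw_byWitness[where f' = G] bij_betw_byWitness[where f' = F])
  ultimately show ?thesis
    using GF FG by blast
qed

end

section \<open>Coxeter systems\<close>

text \<open>Cancellation removes two letters and a relator an even number, so parity of length is an
  invariant; for Coxeter groups this is the sign character.\<close>

lemma pres_eq_even_length:
  assumes "pres_eq S Rels u v" "\<And>r. r \<in> Rels \<Longrightarrow> even (length r)"
  shows "even (length u) \<longleftrightarrow> even (length v)"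
  using assms by induction auto

lemma coxeter_system_involution_generated:
  fixes W :: "('w, 'b) monoid_scheme"
  assumes "coxeter_system W S"
  shows "involution_generated_group W S"
proof -
  obtain m where m: "coxeter_matrix S m" and pres: "presented_by W S (coxeter_relators S m)"
    using assms by (auto simp: coxeter_system_def)
  interpret group W
    using pres by (simp add: presented_by_def)
  have closed: "S \<subseteq> carrier W" and gen: "gword_val W ` gwords S = carrier W"
    and eq: "\<And>u v. u \<in> gwords S \<Longrightarrow> v \<in> gwords S \<Longrightarrow>
      gword_val W u = gword_val W v \<longleftrightarrow> pres_eq S (coxeter_relators S m) u v"
    using pres by (auto simp: presented_by_def)
  \<comment> \<open>The diagonal entries of the Coxeter matrix are 1, so the word \<open>s s\<close>
    is itself a relator.\<close>
  have inv2: "s \<otimes>\<^bsub>W\<^esub> s = \<one>\<^bsub>W\<^esub>" if s: "s \<in> S" for s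
  proof -
    have "m s s = 1" using m s by (simp add: coxeter_matrix_def)
    then have "concat (replicate (m s s) [(s, True), (s, True)]) = [(s, True), (s, True)]"
      by simp
    then have "[(s, True), (s, True)] \<in> coxeter_relators S m"
      using s \<open>m s s = 1\<close> unfolding coxeter_relators_def by force
    then have "pres_eq S (coxeter_relators S m) [(s, True), (s, True)] []"
      using pres_eq.relator[of "[]" S "[]" "[(s, True), (s, True)]"] by (simp add: gwords_def)
    then have "gword_val W [(s, True), (s, True)] = gword_val W []"
      using s by (subst eq) (auto simp: gwords_def)
    then show ?thesis
      using s closed by (auto simp: gword_val_def word_prod_def)
  qed
  have inv_gen: "inv\<^bsub>W\<^esub> s = s" if "s \<in> S" for s
    using that inv2 closed by (intro inv_equality) auto
  have positive: "gword_val W u = word_prod W (map fst u)" if "u \<in> gwords S" for u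
  proof -
    have "map (\<lambda>(s, b). if b then s else inv\<^bsub>W\<^esub> s) u = map fst u"
      using that inv_gen by (auto simp: gwords_def in_lists_conv_set)
    then show ?thesis unfolding gword_val_def by (rule arg_cong)
  qed
  have generated: "\<exists>ws \<in> lists S. word_prod W ws = w" if w: "w \<in> carrier W" for w
  proof -
    obtain u where u: "u \<in> gwords S" "gword_val W u = w"
      using w unfolding gen[symmetric] by blast
    then have "map fst u \<in> lists S"
      by (auto simp: gwords_def in_lists_conv_set)
    then show ?thesis
      using positive u by metis
  qed
  \<comment> \<open>Each Coxeter relator repeats a two-letter word, so it has even length.\<close>
  have parity: "even (length us) \<longleftrightarrow> even (length vs)"
    if "us \<in> lists S" "vs \<in> lists S" "word_prod W us = word_prod W vs" for us vs
  proof -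
    let ?g = "map (\<lambda>s. (s, True))"
    have gw: "?g us \<in> gwords S" "?g vs \<in> gwords S"
      using that by (auto simp: gwords_def in_lists_conv_set)
    then have "gword_val W (?g us) = gword_val W (?g vs)"
      using that positive by (simp add: comp_def)
    then have "pres_eq S (coxeter_relators S m) (?g us) (?g vs)"
      using eq gw by blast
    moreover have "even (length r)" if "r \<in> coxeter_relators S m" for r
      using that by (auto simp: coxeter_relators_def length_concat sum_list_replicate)
    ultimately show ?thesis
      using pres_eq_even_length by fastforce
  qed
  have shortest: "\<exists>ws \<in> lists S. length ws = len W S w \<and> word_prod W ws = w"
    if "w \<in> carrier W" for w
    unfolding len_def by (rule LeastI_ex) (use generated[OF that] in blast)
  have "len W S (s \<otimes>\<^bsub>W\<^esub> w) \<noteq> len W S w" if s: "s \<in> S" and w: "w \<in> carrier W" for s w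
  proof -
    have "s \<otimes>\<^bsub>W\<^esub> w \<in> carrier W" using s w closed by auto
    then obtain us where us: "us \<in> lists S" "length us = len W S (s \<otimes>\<^bsub>W\<^esub> w)"
      "word_prod W us = s \<otimes>\<^bsub>W\<^esub> w"
      using shortest by blast
    obtain vs where vs: "vs \<in> lists S" "length vs = len W S w" "word_prod W vs = w"
      using shortest[OF w] by blast
    \<comment> \<open>Two words for the same element have lengths of equal parity; here they are one
      more than the length of \<open>w\<close> and the length of \<open>s\<close> times
      \<open>w\<close>.\<close>
    have "word_prod W (s # vs) = word_prod W us"
      using vs us by (simp add: word_prod_def)
    then have "even (length (s # vs)) \<longleftrightarrow> even (length us)"
      using parity[of "s # vs" us] us(1) vs(1) s by simp
    then show ?thesis using us vs by auto
  qed
  then show ?thesis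
    using closed inv2 generated by unfold_locales auto
qed

theorem theorem3p16:
  fixes W :: "('w, 'b) monoid_scheme" and S :: "'w set"
  assumes "coxeter_system W S" and "finite S"
  shows "(\<forall>A :: ('q, 'w) automaton. reduced_automaton W S A \<longrightarrow>
            regular_partition W S (partition_of_automaton W S A - {{}}) \<and>
            (accessible S A \<longrightarrow> regular_partition W S (partition_of_automaton W S A))) \<and>
         (\<forall>P \<in> regular_partitions W S.
            automaton_of_partition W S P \<in> reduced_automata W S) \<and>
         ((\<exists>h :: 'w \<Rightarrow> 'q. inj_on h (carrier W)) \<longrightarrow>
            (let F = (class_of_partition W S :: 'w set set \<Rightarrow> ('q, 'w) automaton set);
                 G = (partition_of_class W S :: ('q, 'w) automaton set \<Rightarrow> 'w set set);
                 Preg = regular_partitions W S;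
                 Ared = (reduced_automata_classes W S :: ('q, 'w) automaton set set)
             in bij_betw F Preg Ared \<and> bij_betw G Ared Preg \<and>
                (\<forall>P \<in> Preg. G (F P) = P) \<and>
                (\<forall>C \<in> Ared. F (G C) = C) \<and>
                (\<forall>C \<in> Ared. \<forall>A \<in> C. G C = partition_of_automaton W S A)))"
proof -
  interpret involution_generated_group W S
    using assms(1) by (rule coxeter_system_involution_generated)
  show ?thesis
    unfolding Let_def
  proof (rule conjI[OF _ conjI]; intro allI impI ballI)
    fix A :: "('q, 'w) automaton" assume "reduced_automaton W S A"
    then show "regular_partition W S (partition_of_automaton W S A - {{}}) \<and>
        (accessible S A \<longrightarrow> regular_partition W S (partition_of_automaton W S A))"
      using regular_partition_of_automaton regular_partition_of_accessible by blast
  next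
    fix P assume "P \<in> regular_partitions W S"
    then show "automaton_of_partition W S P \<in> reduced_automata W S"
      by (simp add: regular_partitions_def automaton_of_partition_reduced)
  qed (erule exE, rule bijections)
qed

end
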